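(* Let $K \in \mathbb{N}$, and let $p_1,\ldots,p_K$ be pairwise distinct primes. For $i \in \{1,\ldots,K\}$ let $L_i, M_i \in \mathbb{N}$, and let $\alpha(i,j) \in \mathbb{N}_0$ for $1 \le j \le L_i$ and $\beta(i,j) \in \mathbb{N}_0$ for $1 \le j \le M_i$. Let $A := \prod_{i=1}^K \prod_{j=1}^{L_i} \mathbb{Z}_{p_i^{\alpha(i,j)}}$ and $B := \prod_{i=1}^K \prod_{j=1}^{M_i} \mathbb{Z}_{p_i^{\beta(i,j)}}$, and let $f : A \to B$ be a function. Then the following are equivalent: (1) $f$ is of finite functional degree, i.e., $\operatorname{Fdeg}(f) < \infty$. (2) For all $i_1, i_2 \in \{1,\ldots,K\}$, $j_1 \in \{1,\ldots,L_{i_1}\}$ and $j_2 \in \{1,\ldots,M_{i_2}\}$ we have: if $i_1 \ne i_2$, then the $(i_2,j_2)$-th component of the value $f(a)$ does not depend on the $(i_1,j_1)$-th component of $a$. (3) $\displaystyle \operatorname{Fdeg}(f) \le \max_{1 \le i \le K} \Big( \big(\max_{1 \le j \le M_i} \beta(i,j)\big) \cdot \big(\sum_{j=1}^{L_i} (p_i^{\alpha(i,j)} - 1)\big) \Big)$.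
   Context: $\mathbb{N}$ is the set of positive integers, $\mathbb{N}_0 = \mathbb{N} \cup \{0\}$; abelian groups are written additively and $\mathbb{Z}_n$ is the cyclic group of order $n$. For an abelian group $A$, $\mathbb{Z}[A]$ is the integral group ring; its elements are written as finite sums $\sum_{a\in A} z_a \tau_a$ with $z_a \in \mathbb{Z}$, and $\tau_a \cdot \tau_b = \tau_{a+b}$. The augmentation ideal $\operatorname{Aug}(\mathbb{Z}[A])$ is the ideal of $\mathbb{Z}[A]$ generated by $\{\tau_a - 1 \mid a \in A\}$. For an ideal $I$, $I^0 = \mathbb{Z}[A]$ and $I^n$ is the ideal generated by all products $i_1\cdots i_n$ with $i_1,\ldots,i_n \in I$. For an abelian group $B$, the ring $\mathbb{Z}[A]$ acts on the group $B^A$ of all functions $f : A \to B$ by $((\sum_{a} z_a \tau_a) * f)(x) = \sum_{a} z_a f(x+a)$. For an ideal $J$, $J * f = 0$ means $j * f = 0$ for all $j \in J$. Functional degree: for a function $f : A \to B$ between abelian groups and $I := \operatorname{Aug}(\mathbb{Z}[A])$, $\operatorname{Fdeg}(f) := \min\{ n \in \mathbb{N}_0 \mid I^{n+1} * f = 0\}$, with $\operatorname{Fdeg}(f) = \infty$ if no such $n$ exists. *)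

theory Defs
  imports "HOL-Algebra.Algebra" "HOL-Library.Extended_Nat"
begin

text \<open>
  Abelian groups are structures of HOL-Algebra, hence written multiplicatively:
  \<open>\<otimes>\<close>, \<open>\<one>\<close> and \<open>[^]\<close> stand for addition, zero and integer multiples.

  Elements of the integral group ring are finitely supported integer-valued functions;
  \<open>frag_of a\<close> is the basis element \<open>\<tau>\<^sub>a\<close>. The multiplication is the bilinear extension of
  \<open>\<tau>\<^sub>a \<cdot> \<tau>\<^sub>b = \<tau>\<^sub>a\<^sub>+\<^sub>b\<close>; it is not the product that the library puts on
  \<open>'a \<Rightarrow>\<^sub>0 int\<close>, because the group is not given by a type class.
\<close>

definition group_ring :: "('a, 'm) monoid_scheme \<Rightarrow> ('a \<Rightarrow>\<^sub>0 int) ring" where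
  "group_ring A =
     \<lparr>carrier = {z. Poly_Mapping.keys z \<subseteq> carrier A},
      monoid.mult = (\<lambda>y z. frag_extend (\<lambda>a. frag_extend (\<lambda>b. frag_of (a \<otimes>\<^bsub>A\<^esub> b)) z) y),
      one = frag_of \<one>\<^bsub>A\<^esub>,
      ring.zero = 0,
      add = (+)\<rparr>"

lemma group_ring_cring:
  assumes "comm_group A"
  shows "cring (group_ring A)"
proof -
  interpret A: comm_group A by fact
  let ?m = "\<lambda>y z. frag_extend (\<lambda>a. frag_extend (\<lambda>b. frag_of (a \<otimes>\<^bsub>A\<^esub> b)) z) y"
  let ?C = "{z :: 'a \<Rightarrow>\<^sub>0 int. Poly_Mapping.keys z \<subseteq> carrier A}"
  have clo: "?m y z \<in> ?C" if "y \<in> ?C" "z \<in> ?C" for y z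
    using that keys_frag_extend[of "\<lambda>a. frag_extend (\<lambda>b. frag_of (a \<otimes>\<^bsub>A\<^esub> b)) z" y]
      keys_frag_extend[of "\<lambda>b. frag_of (a \<otimes>\<^bsub>A\<^esub> b)" z for a]
    by (fastforce simp: subset_iff)
  have addl: "?m (x + y) z = ?m x z + ?m y z" for x y z
    by (rule frag_extend_add)
  have diffl: "?m (x - y) z = ?m x z - ?m y z" for x y z
    by (rule frag_extend_diff)
  have diffr: "?m x (y - z) = ?m x y - ?m x z" for x y z
    using subset_UNIV[of "Poly_Mapping.keys x"]
    by (induction x rule: frag_induction) (auto simp: frag_extend_diff)
  have comm: "?m x y = ?m y x" if "x \<in> ?C" "y \<in> ?C" for x y
  proof -
    from that(1)[simplified] show ?thesis
    proof (induction x rule: frag_induction)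
      case (one a)
      from that(2)[simplified] show ?case
        using one by (induction y rule: frag_induction) (simp_all add: frag_extend_diff frag_extend_eq_0 A.m_comm)
    qed (simp_all add: diffl diffr frag_extend_eq_0)
  qed
  have assoc: "?m (?m x y) z = ?m x (?m y z)" if "x \<in> ?C" "y \<in> ?C" "z \<in> ?C" for x y z
  proof -
    from that(1)[simplified] show ?thesis
    proof (induction x rule: frag_induction)
      case (one a)
      from that(2)[simplified] show ?case
      proof (induction y rule: frag_induction)
        case (one b)
        from that(3)[simplified] show ?case
          using one \<open>a \<in> carrier A\<close>
          by (induction z rule: frag_induction) (simp_all add: frag_extend_diff frag_extend_eq_0 A.m_assoc)
      qed (simp_all add: diffl diffr frag_extend_diff frag_extend_eq_0)
    qed (simp_all add: diffl diffr frag_extend_eq_0)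
  qed
  have one: "?m (frag_of \<one>\<^bsub>A\<^esub>) x = x" if "x \<in> ?C" for x
    using that[simplified]
    by (induction x rule: frag_induction) (simp_all add: frag_extend_diff)
  show ?thesis
  proof (rule cringI)
    show "abelian_group (group_ring A)"
    proof (rule abelian_groupI)
      fix x assume "x \<in> carrier (group_ring A)"
      then show "\<exists>y\<in>carrier (group_ring A). y \<oplus>\<^bsub>group_ring A\<^esub> x = \<zero>\<^bsub>group_ring A\<^esub>"
        by (intro bexI[of _ "- x"]) (auto simp: group_ring_def)
    qed (use keys_add in \<open>fastforce simp: group_ring_def\<close>)+
    show "comm_monoid (group_ring A)"
      by (rule comm_monoidI)
         (use clo comm assoc one in \<open>auto simp: group_ring_def\<close>)
  qed (simp add: group_ring_def addl)
qed

definition augmentation_ideal :: "('a, 'm) monoid_scheme \<Rightarrow> ('a \<Rightarrow>\<^sub>0 int) set" where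
  "augmentation_ideal A =
     Idl\<^bsub>group_ring A\<^esub> {frag_of a \<ominus>\<^bsub>group_ring A\<^esub> \<one>\<^bsub>group_ring A\<^esub> | a. a \<in> carrier A}"

definition ideal_power :: "('r, 'm) ring_scheme \<Rightarrow> 'r set \<Rightarrow> nat \<Rightarrow> 'r set" where
  "ideal_power R I n =
     (if n = 0 then carrier R
      else Idl\<^bsub>R\<^esub> {finprod R x {1..n} | x. x \<in> {1..n} \<rightarrow> I})"

definition group_ring_act ::
  "('a, 'm) monoid_scheme \<Rightarrow> ('b, 'n) monoid_scheme \<Rightarrow> ('a \<Rightarrow>\<^sub>0 int) \<Rightarrow> ('a \<Rightarrow> 'b) \<Rightarrow> 'a \<Rightarrow> 'b" where
  "group_ring_act A B z f =
     (\<lambda>x\<in>carrier A. \<Otimes>\<^bsub>B\<^esub>a\<in>Poly_Mapping.keys z. f (x \<otimes>\<^bsub>A\<^esub> a) [^]\<^bsub>B\<^esub> Poly_Mapping.lookup z a)"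

definition annihilates ::
  "('a, 'm) monoid_scheme \<Rightarrow> ('b, 'n) monoid_scheme \<Rightarrow> ('a \<Rightarrow>\<^sub>0 int) set \<Rightarrow> ('a \<Rightarrow> 'b) \<Rightarrow> bool" where
  "annihilates A B J f \<longleftrightarrow> (\<forall>z\<in>J. group_ring_act A B z f = (\<lambda>x\<in>carrier A. \<one>\<^bsub>B\<^esub>))"

definition Fdeg ::
  "('a, 'm) monoid_scheme \<Rightarrow> ('b, 'n) monoid_scheme \<Rightarrow> ('a \<Rightarrow> 'b) \<Rightarrow> enat" where
  "Fdeg A B f =
     (let P = (\<lambda>n. annihilates A B (ideal_power (group_ring A) (augmentation_ideal A) (n + 1)) f)
      in if \<exists>n. P n then enat (LEAST n. P n) else \<infinity>)"

end

theory Submission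
  imports Defs
begin

text \<open>
  The ideal power \<open>I\<^sup>n\<close> annihilates \<open>f\<close> iff all \<open>n\<close>-fold differences of \<open>f\<close> vanish, which can be
  tested on each component of \<open>f\<close>, an integer-valued function modulo \<open>p\<^sub>i ^ \<beta>(i,j)\<close>, and with
  differences along the coordinate vectors only.

  If \<open>f\<close> has finite degree, a component modulo a power of \<open>p\<^sub>i\<close> is invariant under translations
  of order prime to \<open>p\<^sub>i\<close>: when the second difference along such a translation vanishes, the
  function is affine along it and periodic with a period that is invertible modulo \<open>p\<^sub>i\<close>, hence
  constant.

  Conversely, if \<open>\<tau>\<close> has order \<open>q = p ^ \<alpha>\<close>, then
  \<open>(\<tau> - 1) ^ q = - (\<Sum>0 < k < q. (q choose k) (\<tau> - 1) ^ k)\<close> with all coefficients divisible by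
  \<open>p\<close>. So among more than \<open>b S\<close> differences along coordinate vectors of one primary block, where
  \<open>S = \<Sum>j. p ^ \<alpha>\<^sub>j - 1\<close>, a factor \<open>p\<close> can be extracted \<open>b\<close> times at a cost of at most \<open>S\<close>
  differences each.
\<close>

section \<open>Finite differences of integer-valued functions\<close>

lemma prime_dvd_prime_power_choose:
  fixes p :: nat
  assumes p: "Factorial_Ring.prime p" and k: "0 < k" "k < p ^ m"
  shows "p dvd (p ^ m choose k)"
proof (rule ccontr)
  assume "\<not> p dvd (p ^ m choose k)"
  then have "coprime (p ^ m) (p ^ m choose k)"
    using p by (simp add: prime_imp_coprime)
  moreover have "k * (p ^ m choose k) = p ^ m * (p ^ m - 1 choose (k - 1))"
    using k times_binomial_minus1_eq by blast
  then have "p ^ m dvd k * (p ^ m choose k)" by simp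
  ultimately have "p ^ m dvd k" by (simp add: coprime_dvd_mult_left_iff)
  with k show False by (auto dest: dvd_imp_le)
qed

definition translate :: "('a, 'm) monoid_scheme \<Rightarrow> 'a \<Rightarrow> ('a \<Rightarrow> int) \<Rightarrow> 'a \<Rightarrow> int" where
  "translate A a g = (\<lambda>x. if x \<in> carrier A then g (x \<otimes>\<^bsub>A\<^esub> a) else 0)"

definition difference :: "('a, 'm) monoid_scheme \<Rightarrow> 'a \<Rightarrow> ('a \<Rightarrow> int) \<Rightarrow> 'a \<Rightarrow> int" where
  "difference A a g = (\<lambda>x. if x \<in> carrier A then g (x \<otimes>\<^bsub>A\<^esub> a) - g x else 0)"

primrec differences_dvd ::
  "('a, 'm) monoid_scheme \<Rightarrow> 'a set \<Rightarrow> int \<Rightarrow> nat \<Rightarrow> ('a \<Rightarrow> int) \<Rightarrow> bool" where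
  "differences_dvd A S q 0 g \<longleftrightarrow> (\<forall>x\<in>carrier A. q dvd g x)"
| "differences_dvd A S q (Suc n) g \<longleftrightarrow> (\<forall>a\<in>S. differences_dvd A S q n (difference A a g))"

lemma difference_diff:
  "difference A a (\<lambda>x. g x - h x) = (\<lambda>x. difference A a g x - difference A a h x)"
  by (auto simp: difference_def)

lemma difference_zero [simp]: "difference A a (\<lambda>x. 0) = (\<lambda>x. 0)"
  by (simp add: difference_def fun_eq_iff)

lemma difference_sum:
  "difference A a (\<lambda>x. \<Sum>k\<in>T. c k * h k x) = (\<lambda>x. \<Sum>k\<in>T. c k * difference A a (h k) x)"
  by (auto simp: difference_def sum_subtractf right_diff_distrib)

lemma fold_difference_sum:
  "fold (\<lambda>j. difference A (u j)) js (\<lambda>x. \<Sum>k\<in>T. c k * h k x) =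
   (\<lambda>x. \<Sum>k\<in>T. c k * fold (\<lambda>j. difference A (u j)) js (h k) x)"
  by (induction js arbitrary: h) (simp_all add: difference_sum)

lemma fold_difference_zero [simp]: "fold (\<lambda>j. difference A (u j)) js (\<lambda>x. 0) = (\<lambda>x. 0)"
  by (induction js) simp_all

lemma differences_dvd_zero [simp]: "differences_dvd A S q n (\<lambda>x. 0)"
  by (induction n) simp_all

lemma differences_dvd_diff:
  "differences_dvd A S q n g \<Longrightarrow> differences_dvd A S q n h \<Longrightarrow>
   differences_dvd A S q n (\<lambda>x. g x - h x)"
  by (induction n arbitrary: g h) (simp_all add: difference_diff)

lemma differences_dvd_add:
  assumes "differences_dvd A S q n g" "differences_dvd A S q n h"
  shows "differences_dvd A S q n (\<lambda>x. g x + h x)"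
  using differences_dvd_diff[OF assms(1) differences_dvd_diff[OF differences_dvd_zero assms(2)]]
  by simp

lemma differences_dvd_funpow:
  assumes "a \<in> S" "differences_dvd A S q n g" "x \<in> carrier A"
  shows "q dvd (difference A a ^^ n) g x"
  using assms(2) by (induction n arbitrary: g) (use assms in \<open>simp_all add: funpow_swap1\<close>)

lemma differences_dvd_image_fold:
  "differences_dvd A (u ` J) q n g \<longleftrightarrow>
   (\<forall>js x. set js \<subseteq> J \<longrightarrow> length js = n \<longrightarrow> x \<in> carrier A \<longrightarrow>
      q dvd fold (\<lambda>j. difference A (u j)) js g x)"
proof (induction n arbitrary: g)
  case (Suc n)
  show ?case (is "_ \<longleftrightarrow> ?R")
  proof
    assume L: "differences_dvd A (u ` J) q (Suc n) g"
    show ?R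
    proof (intro allI impI)
      fix js x
      assume js: "set js \<subseteq> J" "length js = Suc n" and x: "x \<in> carrier A"
      obtain k ks where "js = k # ks" using js(2) by (cases js) auto
      then show "q dvd fold (\<lambda>j. difference A (u j)) js g x"
        using L js x Suc[of "difference A (u k) g"] by simp
    qed
  next
    assume R: ?R
    have "differences_dvd A (u ` J) q n (difference A (u k) g)" if "k \<in> J" for k
      unfolding Suc
    proof (intro allI impI)
      fix js x
      assume "set js \<subseteq> J" "length js = n" "x \<in> carrier A"
      then show "q dvd fold (\<lambda>j. difference A (u j)) js (difference A (u k) g) x"
        using R[rule_format, of "k # js" x] that by simp
    qed
    then show "differences_dvd A (u ` J) q (Suc n) g" by simp
  qed
qed auto

context comm_group
begin

lemma difference_commute:
  assumes "a \<in> carrier G" "b \<in> carrier G"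
  shows "difference G a (difference G b g) = difference G b (difference G a g)"
  using assms by (auto simp: difference_def fun_eq_iff m_assoc m_comm[of a b])

lemma difference_translate:
  assumes "a \<in> carrier G" "b \<in> carrier G"
  shows "difference G a (translate G b g) = translate G b (difference G a g)"
  using assms by (auto simp: difference_def translate_def fun_eq_iff m_assoc m_comm[of a b])

lemma differences_dvd_translate:
  assumes "S \<subseteq> carrier G" "b \<in> carrier G" "differences_dvd G S q n g"
  shows "differences_dvd G S q n (translate G b g)"
  using assms(3)
proof (induction n arbitrary: g)
  case 0
  with assms show ?case by (simp add: translate_def)
next
  case (Suc n)
  with assms show ?case by (simp add: difference_translate subset_iff)
qed

lemma difference_dvd:
  assumes "a \<in> carrier G" "\<And>x. x \<in> carrier G \<Longrightarrow> q dvd h x" "x \<in> carrier G"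
  shows "q dvd difference G a h x"
  using assms by (simp add: difference_def)

lemma difference_mult:
  assumes "a \<in> carrier G" "b \<in> carrier G"
  shows "difference G (a \<otimes> b) g = (\<lambda>x. difference G a g x + translate G a (difference G b g) x)"
  using assms by (auto simp: difference_def translate_def fun_eq_iff m_assoc)

lemma differences_dvd_generators:
  assumes S: "S \<subseteq> carrier G"
    and gen: "\<And>Q. \<one> \<in> Q \<Longrightarrow> S \<subseteq> Q \<Longrightarrow> (\<And>a b. a \<in> Q \<Longrightarrow> b \<in> Q \<Longrightarrow> a \<otimes> b \<in> Q) \<Longrightarrow> carrier G \<subseteq> Q"
    and V: "differences_dvd G S q n g"
  shows "differences_dvd G (carrier G) q n g"
  using V
proof (induction n arbitrary: g)
  case (Suc n)
  let ?Q = "{a \<in> carrier G. differences_dvd G (carrier G) q n (difference G a g)}"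
  have "difference G \<one> g = (\<lambda>x. 0)"
    by (auto simp: difference_def)
  then have "carrier G \<subseteq> ?Q"
    using Suc S
    by (intro gen) (auto simp: difference_mult intro!: differences_dvd_add differences_dvd_translate)
  then show ?case by auto
qed simp

lemma newton_forward_difference:
  assumes a: "a \<in> carrier G" and x: "x \<in> carrier G"
  shows "g (x \<otimes> a [^] n) = (\<Sum>k\<le>n. int (n choose k) * (difference G a ^^ k) g x)"
proof (induction n arbitrary: g)
  case 0
  with x show ?case by simp
next
  case (Suc n)
  let ?h = "\<lambda>k. (difference G a ^^ k) g x"
  have "g (x \<otimes> a [^] Suc n) = g (x \<otimes> a [^] n) + difference G a g (x \<otimes> a [^] n)"
    using a x by (simp add: difference_def m_assoc)
  also have "\<dots> = (\<Sum>k\<le>n. int (n choose k) * ?h k) + (\<Sum>k\<le>n. int (n choose k) * ?h (Suc k))"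
    unfolding Suc by (simp add: funpow_swap1)
  also have "(\<Sum>k\<le>n. int (n choose k) * ?h k) = (\<Sum>k\<le>Suc n. int (n choose k) * ?h k)"
    by simp
  also have "\<dots> = ?h 0 + (\<Sum>k\<le>n. int (n choose Suc k) * ?h (Suc k))"
    by (subst sum.atMost_Suc_shift) simp
  also have "\<dots> + (\<Sum>k\<le>n. int (n choose k) * ?h (Suc k)) =
      ?h 0 + (\<Sum>k\<le>n. int (Suc n choose Suc k) * ?h (Suc k))"
    by (simp add: sum.distrib distrib_right)
  also have "\<dots> = (\<Sum>k\<le>Suc n. int (Suc n choose k) * ?h k)"
    by (subst sum.atMost_Suc_shift) simp
  finally show ?case .
qed

lemma difference_funpow_order:
  assumes a: "a \<in> carrier G" and q: "a [^] q = \<one>" "q \<ge> 1"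
  shows "(difference G a ^^ q) g =
    (\<lambda>x. \<Sum>k\<in>{1..<q}. - int (q choose k) * (difference G a ^^ k) g x)"
proof
  fix x
  let ?h = "\<lambda>k. (difference G a ^^ k) g x"
  show "?h q = (\<Sum>k\<in>{1..<q}. - int (q choose k) * ?h k)"
  proof (cases "x \<in> carrier G")
    case True
    have set: "{..q} = insert 0 (insert q {1..<q})" using q(2) by auto
    have "g x = (\<Sum>k\<le>q. int (q choose k) * ?h k)"
      using newton_forward_difference[OF a True, of g q] q True by simp
    also have "\<dots> = g x + (?h q + (\<Sum>k\<in>{1..<q}. int (q choose k) * ?h k))"
      unfolding set using q(2) by simp
    finally show ?thesis by (simp add: sum_negf)
  next
    case False
    have "?h k = 0" if "k \<ge> 1" for k
      using that False by (cases k) (auto simp: difference_def)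
    with q show ?thesis by simp
  qed
qed

lemma fold_difference_cong_mset:
  assumes "u \<in> J \<rightarrow> carrier G" "set js \<subseteq> J" "mset js = mset ks"
  shows "fold (\<lambda>j. difference G (u j)) js = fold (\<lambda>j. difference G (u j)) ks"
  using assms by (intro fold_multiset_equiv) (auto simp: fun_eq_iff difference_commute Pi_iff subset_iff)

lemma fold_difference_eq_zero:
  assumes "u \<in> J \<rightarrow> carrier G" "set js \<subseteq> J" "k \<in> set js" "difference G (u k) g = (\<lambda>x. 0)"
  shows "fold (\<lambda>j. difference G (u j)) js g = (\<lambda>x. 0)"
proof -
  have "mset js = mset (k # remove1 k js)" using assms(3) by simp
  from fold_difference_cong_mset[OF assms(1,2) this] show ?thesis
    by (simp add: assms(4))
qed

text \<open>In a word that is long enough some letter \<open>j\<close> occurs \<open>p ^ \<alpha> j\<close> times. Rewriting this power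
  gains a factor \<open>p\<close> and shortens the word by at most \<open>p ^ \<alpha> j - 1\<close> letters, because every term
  keeps at least one of them.\<close>

lemma prime_power_dvd_fold_difference:
  fixes p :: nat
  assumes p: "Factorial_Ring.prime p" and fin: "finite J" and u: "u \<in> J \<rightarrow> carrier G"
    and ord: "\<And>j. j \<in> J \<Longrightarrow> u j [^] (p ^ \<alpha> j) = \<one>"
    and x: "x \<in> carrier G"
    and js: "set js \<subseteq> J" "length js > n * (\<Sum>j\<in>J. p ^ \<alpha> j - 1)"
  shows "int p ^ n dvd fold (\<lambda>j. difference G (u j)) js g x"
  using js
proof (induction n arbitrary: js)
  case (Suc n)
  define D where "D = (\<lambda>j. difference G (u j))"
  let ?S = "\<Sum>j\<in>J. p ^ \<alpha> j - 1"
  have "\<exists>j\<in>J. count (mset js) j \<ge> p ^ \<alpha> j"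
  proof (rule ccontr)
    assume "\<not> ?thesis"
    then have "\<And>j. j \<in> J \<Longrightarrow> count (mset js) j \<le> p ^ \<alpha> j - 1" by fastforce
    then have "(\<Sum>j\<in>J. count (mset js) j) \<le> ?S" by (rule sum_mono)
    moreover have "(\<Sum>j\<in>J. count (mset js) j) = length js"
      using sum_count_set[OF Suc.prems(1) fin] by (simp add: count_mset)
    ultimately show False using Suc.prems(2) by simp
  qed
  then obtain j where j: "j \<in> J" and cnt: "count (mset js) j \<ge> p ^ \<alpha> j" by blast
  define q where "q = p ^ \<alpha> j"
  have q1: "q \<ge> 1" using p by (simp add: q_def Suc_le_eq prime_gt_0_nat)
  have qS: "q - 1 \<le> ?S"
    unfolding q_def using fin j by (intro member_le_sum[of j J "\<lambda>j. p ^ \<alpha> j - 1"]) auto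
  obtain ks where ks: "mset ks = mset js - replicate_mset q j"
    using ex_mset by blast
  have "replicate_mset q j \<subseteq># mset js"
    using cnt by (simp add: count_le_replicate_mset_subset_eq[symmetric] q_def)
  then have split: "mset js = mset (replicate q j @ ks)"
    by (simp add: ks)
  have kJ: "set ks \<subseteq> J" and len: "length js = q + length ks"
    using Suc.prems(1) mset_eq_setD[OF split] mset_eq_length[OF split] by auto
  have rep: "fold D (replicate k j @ ks) g = fold D ks ((D j ^^ k) g)" for k
    by (simp add: fold_replicate)
  have "fold D js g x = fold D ks ((D j ^^ q) g) x"
    using fold_difference_cong_mset[OF u Suc.prems(1) split] by (simp add: D_def rep[unfolded D_def])
  also have "(D j ^^ q) g = (\<lambda>x. \<Sum>k\<in>{1..<q}. - int (q choose k) * (D j ^^ k) g x)"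
    unfolding D_def using u j ord[OF j] q1 by (intro difference_funpow_order) (auto simp: q_def)
  also have "fold D ks \<dots> x =
      (\<Sum>k\<in>{1..<q}. - int (q choose k) * fold D (replicate k j @ ks) g x)"
    unfolding rep unfolding D_def by (simp only: fold_difference_sum)
  finally have eq: "fold D js g x =
      (\<Sum>k\<in>{1..<q}. - int (q choose k) * fold D (replicate k j @ ks) g x)" .
  have "int p ^ Suc n dvd fold D js g x"
    unfolding eq
  proof (rule dvd_sum)
    fix k assume k: "k \<in> {1..<q}"
    have "int p dvd - int (q choose k)"
      using k prime_dvd_prime_power_choose[OF p] by (simp add: q_def int_dvd_int_iff)
    moreover have "int p ^ n dvd fold D (replicate k j @ ks) g x"
      unfolding D_def
    proof (rule Suc.IH)
      show "set (replicate k j @ ks) \<subseteq> J" using kJ j by auto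
      show "n * ?S < length (replicate k j @ ks)"
        using Suc.prems(2) len k qS by auto
    qed
    ultimately show "int p ^ Suc n dvd - int (q choose k) * fold D (replicate k j @ ks) g x"
      by (simp add: mult_dvd_mono)
  qed
  then show ?case by (simp add: D_def)
qed simp

text \<open>If \<open>\<Delta>\<^sup>2 h\<close> vanishes modulo \<open>q\<close>, then \<open>h (x + s a) \<equiv> h x + s \<Delta> h x\<close>, so \<open>s \<Delta> h x \<equiv> 0\<close>
  when \<open>s a = 0\<close>. This lowers the order of vanishing differences down to one.\<close>

lemma coprime_order_imp_difference_dvd:
  assumes a: "a \<in> carrier G" and s: "a [^] s = \<one>" and cop: "coprime (int s) q"
    and V: "\<And>x. x \<in> carrier G \<Longrightarrow> q dvd (difference G a ^^ Suc n) g x"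
    and x: "x \<in> carrier G"
  shows "q dvd difference G a g x"
  using V x
proof (induction n arbitrary: x)
  case (Suc n)
  let ?h = "(difference G a ^^ n) g"
  have "q dvd difference G a ?h y" if y: "y \<in> carrier G" for y
  proof -
    have van: "q dvd (difference G a ^^ (k + 2)) ?h z" if "z \<in> carrier G" for k z
      using that
    proof (induction k arbitrary: z)
      case 0
      then show ?case using Suc.prems(1)[of z] by (simp add: eval_nat_numeral)
    next
      case (Suc k)
      have *: "(difference G a ^^ (Suc k + 2)) ?h = difference G a ((difference G a ^^ (k + 2)) ?h)"
        by simp
      show ?case unfolding * by (intro difference_dvd a Suc)
    qed
    have dv: "q dvd int s * difference G a ?h y"
    proof (cases "s = 0")
      case False
      have set: "{..s} = insert 0 (insert 1 {2..s})" using False by auto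
      have "?h y = (\<Sum>k\<le>s. int (s choose k) * (difference G a ^^ k) ?h y)"
        using newton_forward_difference[OF a y, of ?h s] s y by simp
      also have "\<dots> = ?h y + (int s * difference G a ?h y
          + (\<Sum>k\<in>{2..s}. int (s choose k) * (difference G a ^^ k) ?h y))"
        unfolding set by simp
      finally have "int s * difference G a ?h y =
          - (\<Sum>k\<in>{2..s}. int (s choose k) * (difference G a ^^ k) ?h y)"
        by simp
      moreover have "q dvd (\<Sum>k\<in>{2..s}. int (s choose k) * (difference G a ^^ k) ?h y)"
      proof (intro dvd_sum dvd_mult)
        fix k assume "k \<in> {2..s}"
        then have "k - 2 + 2 = k" by (intro le_add_diff_inverse2) simp
        then show "q dvd (difference G a ^^ k) ?h y"
          using van[OF y, of "k - 2"] by (simp only:)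
      qed
      ultimately show ?thesis by simp
    qed simp
    then show ?thesis using cop by (simp add: coprime_dvd_mult_right_iff coprime_commute)
  qed
  then show ?case using Suc.IH Suc.prems(2) by simp
qed simp

end

section \<open>Powers of the augmentation ideal\<close>

definition int_act :: "('a, 'm) monoid_scheme \<Rightarrow> ('a \<Rightarrow>\<^sub>0 int) \<Rightarrow> ('a \<Rightarrow> int) \<Rightarrow> 'a \<Rightarrow> int" where
  "int_act A z g = (\<lambda>x. if x \<in> carrier A
     then \<Sum>a\<in>Poly_Mapping.keys z. Poly_Mapping.lookup z a * g (x \<otimes>\<^bsub>A\<^esub> a) else 0)"

lemma int_act_superset:
  assumes "finite T" "Poly_Mapping.keys z \<subseteq> T" "x \<in> carrier A"
  shows "int_act A z g x = (\<Sum>a\<in>T. Poly_Mapping.lookup z a * g (x \<otimes>\<^bsub>A\<^esub> a))"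
  using assms by (auto simp: int_act_def in_keys_iff intro!: sum.mono_neutral_left)

lemma int_act_zero [simp]: "int_act A 0 g = (\<lambda>x. 0)"
  by (auto simp: int_act_def)

lemma int_act_frag_of: "int_act A (frag_of a) g = translate A a g"
  by (auto simp: int_act_def translate_def fun_eq_iff)

lemma int_act_diff: "int_act A (y - z) g = (\<lambda>x. int_act A y g x - int_act A z g x)"
proof
  fix x
  let ?T = "Poly_Mapping.keys y \<union> Poly_Mapping.keys z"
  show "int_act A (y - z) g x = int_act A y g x - int_act A z g x"
  proof (cases "x \<in> carrier A")
    case True
    then show ?thesis
      using keys_diff[of y z]
      by (simp add: int_act_superset[of ?T] lookup_minus left_diff_distrib sum_subtractf)
  qed (simp add: int_act_def)
qed

lemma carrier_group_ring: "carrier (group_ring A) = {z. Poly_Mapping.keys z \<subseteq> carrier A}"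
  by (simp add: group_ring_def)

context comm_group
begin

interpretation R: cring "group_ring G"
  by (rule group_ring_cring) (rule comm_group_axioms)

lemma group_ring_uminus:
  assumes "z \<in> carrier (group_ring G)"
  shows "\<ominus>\<^bsub>group_ring G\<^esub> z = - z"
  using assms by (intro R.minus_equality) (auto simp: group_ring_def)

lemma int_act_mult:
  assumes "y \<in> carrier (group_ring G)" "z \<in> carrier (group_ring G)"
  shows "int_act G (y \<otimes>\<^bsub>group_ring G\<^esub> z) g = int_act G y (int_act G z g)"
proof -
  have *: "int_act G (frag_extend (\<lambda>b. frag_of (a \<otimes> b)) z) g = translate G a (int_act G z g)"
    if a: "a \<in> carrier G" for a
    using assms(2)[unfolded carrier_group_ring, simplified]
  proof (induction z rule: frag_induction)
    case (one b)
    with a show ?case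
      by (auto simp: int_act_frag_of translate_def fun_eq_iff m_assoc)
  next
    case (diff z w)
    then show ?case
      by (auto simp: frag_extend_diff int_act_diff translate_def)
  qed (simp add: translate_def frag_extend_eq_0 fun_eq_iff)
  have "int_act G (frag_extend (\<lambda>a. frag_extend (\<lambda>b. frag_of (a \<otimes> b)) z) y) g =
      int_act G y (int_act G z g)"
    using assms(1)[unfolded carrier_group_ring, simplified]
    by (induction y rule: frag_induction)
       (simp_all add: * int_act_frag_of frag_extend_diff int_act_diff frag_extend_eq_0)
  then show ?thesis by (simp add: group_ring_def)
qed

lemma differences_dvd_int_act:
  assumes "z \<in> carrier (group_ring G)" "differences_dvd G (carrier G) q n g"
  shows "differences_dvd G (carrier G) q n (int_act G z g)"
  using assms(1)[unfolded carrier_group_ring, simplified]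
  by (induction z rule: frag_induction)
     (simp_all add: assms(2) int_act_frag_of int_act_diff differences_dvd_translate differences_dvd_diff)

lemma ideal_differences_dvd:
  "ideal {z \<in> carrier (group_ring G). differences_dvd G (carrier G) q n (int_act G z g)} (group_ring G)"
    (is "ideal ?I _")
proof (rule idealI[OF R.ring_axioms])
  have add: "int_act G (y \<oplus>\<^bsub>group_ring G\<^esub> z) g = (\<lambda>x. int_act G y g x + int_act G z g x)" for y z
    using int_act_diff[of G y "0 - z" g] int_act_diff[of G 0 z g] by (simp add: group_ring_def)
  have minus: "int_act G (\<ominus>\<^bsub>group_ring G\<^esub> z) g = (\<lambda>x. 0 - int_act G z g x)"
    if "z \<in> carrier (group_ring G)" for z
    using int_act_diff[of G 0 z g] that by (simp add: group_ring_uminus)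
  show "subgroup ?I (add_monoid (group_ring G))"
  proof (rule subgroup.intro)
    fix y z assume "y \<in> ?I" "z \<in> ?I"
    then show "y \<otimes>\<^bsub>add_monoid (group_ring G)\<^esub> z \<in> ?I"
      by (simp add: add differences_dvd_add)
  next
    have "\<zero>\<^bsub>group_ring G\<^esub> \<in> ?I"
      using R.zero_closed by (simp add: group_ring_def)
    then show "\<one>\<^bsub>add_monoid (group_ring G)\<^esub> \<in> ?I" by simp
  next
    fix z assume z: "z \<in> ?I"
    have "\<ominus>\<^bsub>group_ring G\<^esub> z \<in> ?I"
      using z differences_dvd_diff[OF differences_dvd_zero, of G "carrier G" q n "int_act G z g"]
      by (simp add: minus)
    then show "inv\<^bsub>add_monoid (group_ring G)\<^esub> z \<in> ?I"
      by (simp add: a_inv_def)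
  qed auto
next
  fix y z assume y: "y \<in> ?I" and z: "z \<in> carrier (group_ring G)"
  show *: "z \<otimes>\<^bsub>group_ring G\<^esub> y \<in> ?I"
    using y z by (simp add: int_act_mult differences_dvd_int_act)
  then show "y \<otimes>\<^bsub>group_ring G\<^esub> z \<in> ?I"
    using y z R.m_comm by fastforce
qed

lemma augmentation_generator:
  assumes "a \<in> carrier G"
  shows "frag_of a \<ominus>\<^bsub>group_ring G\<^esub> \<one>\<^bsub>group_ring G\<^esub> \<in> carrier (group_ring G)"
    and "int_act G (frag_of a \<ominus>\<^bsub>group_ring G\<^esub> \<one>\<^bsub>group_ring G\<^esub>) g = difference G a g"
proof -
  have a: "frag_of a \<in> carrier (group_ring G)"
    using assms by (simp add: group_ring_def)
  then show "frag_of a \<ominus>\<^bsub>group_ring G\<^esub> \<one>\<^bsub>group_ring G\<^esub> \<in> carrier (group_ring G)"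
    by simp
  have "frag_of a \<ominus>\<^bsub>group_ring G\<^esub> \<one>\<^bsub>group_ring G\<^esub> = frag_of a - frag_of \<one>"
    unfolding a_minus_def group_ring_uminus[OF R.one_closed] by (simp add: group_ring_def)
  then show "int_act G (frag_of a \<ominus>\<^bsub>group_ring G\<^esub> \<one>\<^bsub>group_ring G\<^esub>) g = difference G a g"
    by (auto simp: int_act_diff int_act_frag_of translate_def difference_def)
qed

lemma augmentation_generators_subset:
  "{frag_of a \<ominus>\<^bsub>group_ring G\<^esub> \<one>\<^bsub>group_ring G\<^esub> | a. a \<in> carrier G} \<subseteq> carrier (group_ring G)"
  using augmentation_generator(1) by blast

lemma augmentation_ideal_subset: "augmentation_ideal G \<subseteq> carrier (group_ring G)"
  unfolding augmentation_ideal_def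
  by (intro R.genideal_minimal R.oneideal augmentation_generators_subset)

lemma augmentation_generator_mem:
  assumes "a \<in> carrier G"
  shows "frag_of a \<ominus>\<^bsub>group_ring G\<^esub> \<one>\<^bsub>group_ring G\<^esub> \<in> augmentation_ideal G"
  unfolding augmentation_ideal_def
  using R.genideal_self[OF augmentation_generators_subset] assms by blast

lemma differences_dvd_augmentation_ideal:
  assumes "differences_dvd G (carrier G) q (Suc n) g" "z \<in> augmentation_ideal G"
  shows "differences_dvd G (carrier G) q n (int_act G z g)"
proof -
  have "augmentation_ideal G \<subseteq>
      {z \<in> carrier (group_ring G). differences_dvd G (carrier G) q n (int_act G z g)}"
    unfolding augmentation_ideal_def
    using assms(1) augmentation_generator
    by (intro R.genideal_minimal ideal_differences_dvd) auto
  with assms(2) show ?thesis by blast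
qed

lemma int_act_finprod_Suc:
  assumes "x \<in> {1..Suc n} \<rightarrow> carrier (group_ring G)"
  shows "int_act G (finprod (group_ring G) x {1..Suc n}) g =
    int_act G (finprod (group_ring G) x {1..n}) (int_act G (x (Suc n)) g)"
proof -
  have fin: "finprod (group_ring G) x {1..n} \<in> carrier (group_ring G)"
    using assms by (intro R.finprod_closed) auto
  have "finprod (group_ring G) x {1..Suc n} =
      x (Suc n) \<otimes>\<^bsub>group_ring G\<^esub> finprod (group_ring G) x {1..n}"
    unfolding atLeastAtMostSuc_conv[of 1 n, simplified] One_nat_def
    using assms by (subst R.finprod_insert) auto
  also have "\<dots> = finprod (group_ring G) x {1..n} \<otimes>\<^bsub>group_ring G\<^esub> x (Suc n)"
    using assms fin by (intro R.m_comm) auto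
  finally show ?thesis
    using assms fin by (simp add: int_act_mult Pi_iff)
qed

lemma int_act_one:
  assumes "x \<in> carrier G"
  shows "int_act G \<one>\<^bsub>group_ring G\<^esub> g x = g x"
  using assms by (simp add: group_ring_def int_act_frag_of translate_def)

lemma differences_dvd_iff_finprod:
  "differences_dvd G (carrier G) q n g \<longleftrightarrow>
   (\<forall>x \<in> {1..n} \<rightarrow> augmentation_ideal G. \<forall>y\<in>carrier G.
      q dvd int_act G (finprod (group_ring G) x {1..n}) g y)"
proof (induction n arbitrary: g)
  case 0
  show ?case by (simp add: int_act_one)
next
  case (Suc n)
  let ?R = "group_ring G" and ?I = "augmentation_ideal G"
  show ?case (is "_ \<longleftrightarrow> ?rhs")
  proof
    assume L: "differences_dvd G (carrier G) q (Suc n) g"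
    show ?rhs
    proof (intro ballI)
      fix x y assume x: "x \<in> {1..Suc n} \<rightarrow> ?I" and y: "y \<in> carrier G"
      have "differences_dvd G (carrier G) q n (int_act G (x (Suc n)) g)"
        using x by (intro differences_dvd_augmentation_ideal[OF L]) auto
      moreover have "x \<in> {1..n} \<rightarrow> ?I" using x by auto
      ultimately have "q dvd int_act G (finprod ?R x {1..n}) (int_act G (x (Suc n)) g) y"
        using Suc y by blast
      moreover have "x \<in> {1..Suc n} \<rightarrow> carrier ?R"
        using x augmentation_ideal_subset by blast
      ultimately show "q dvd int_act G (finprod ?R x {1..Suc n}) g y"
        by (simp only: int_act_finprod_Suc)
    qed
  next
    assume R: ?rhs
    have "differences_dvd G (carrier G) q n (difference G a g)" if a: "a \<in> carrier G" for a
      unfolding Suc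
    proof (intro ballI)
      fix x y assume x: "x \<in> {1..n} \<rightarrow> ?I" and y: "y \<in> carrier G"
      let ?e = "frag_of a \<ominus>\<^bsub>?R\<^esub> \<one>\<^bsub>?R\<^esub>"
      let ?x = "x(Suc n := ?e)"
      have x': "?x \<in> {1..Suc n} \<rightarrow> ?I"
        using x augmentation_generator_mem[OF a] by auto
      then have x'': "?x \<in> {1..Suc n} \<rightarrow> carrier ?R"
        using augmentation_ideal_subset by blast
      have "finprod ?R ?x {1..n} = finprod ?R x {1..n}"
        using x augmentation_ideal_subset by (intro R.finprod_cong') auto
      then have "int_act G (finprod ?R ?x {1..Suc n}) g =
          int_act G (finprod ?R x {1..n}) (difference G a g)"
        unfolding int_act_finprod_Suc[OF x''] by (simp only: fun_upd_same augmentation_generator(2)[OF a])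
      then show "q dvd int_act G (finprod ?R x {1..n}) (difference G a g) y"
        using R[rule_format, OF x' y] by (simp only:)
    qed
    then show "differences_dvd G (carrier G) q (Suc n) g" by simp
  qed
qed

lemma ideal_power_int_act_dvd_iff:
  "(\<forall>z\<in>ideal_power (group_ring G) (augmentation_ideal G) n. \<forall>x\<in>carrier G. q dvd int_act G z g x)
   \<longleftrightarrow> differences_dvd G (carrier G) q n g" (is "?L \<longleftrightarrow> ?V")
proof (cases "n = 0")
  case True
  have "\<one>\<^bsub>group_ring G\<^esub> \<in> ideal_power (group_ring G) (augmentation_ideal G) n"
    by (simp add: ideal_power_def True)
  then have "q dvd g x" if ?L "x \<in> carrier G" for x
    using that int_act_one[OF that(2), of g] by metis
  then have "?L \<Longrightarrow> ?V" by (simp add: True)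
  moreover have "?V \<Longrightarrow> ?L"
    using differences_dvd_int_act[of _ q 0 g] True by (auto simp: ideal_power_def)
  ultimately show ?thesis by blast
next
  case False
  let ?P = "{finprod (group_ring G) x {1..n} | x. x \<in> {1..n} \<rightarrow> augmentation_ideal G}"
  have P: "?P \<subseteq> carrier (group_ring G)"
    using augmentation_ideal_subset by (auto intro!: R.finprod_closed)
  show ?thesis
  proof
    assume L: ?L
    have "?P \<subseteq> ideal_power (group_ring G) (augmentation_ideal G) n"
      using R.genideal_self[OF P] False by (simp add: ideal_power_def)
    with L show ?V
      unfolding differences_dvd_iff_finprod by blast
  next
    assume V: ?V
    have "ideal_power (group_ring G) (augmentation_ideal G) n \<subseteq>
      {z \<in> carrier (group_ring G). differences_dvd G (carrier G) q 0 (int_act G z g)}"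
      unfolding ideal_power_def using False V[unfolded differences_dvd_iff_finprod] P
      by (simp only: if_False, intro R.genideal_minimal ideal_differences_dvd) auto
    then show ?L by auto
  qed
qed

end

section \<open>Products of cyclic groups\<close>

definition cyclic_product ::
  "nat \<Rightarrow> (nat \<Rightarrow> nat) \<Rightarrow> (nat \<Rightarrow> nat \<Rightarrow> nat) \<Rightarrow> (nat \<Rightarrow> nat \<Rightarrow> int) monoid" where
  "cyclic_product K L m =
     product_group {1..K} (\<lambda>i. product_group {1..L i} (\<lambda>j. integer_mod_group (m i j)))"

definition coord ::
  "nat \<Rightarrow> (nat \<Rightarrow> nat) \<Rightarrow> (nat \<Rightarrow> nat \<Rightarrow> nat) \<Rightarrow> nat \<Rightarrow> nat \<Rightarrow> int \<Rightarrow> nat \<Rightarrow> nat \<Rightarrow> int" where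
  "coord K L m i j t =
     (\<lambda>i'\<in>{1..K}. \<lambda>j'\<in>{1..L i'}. if i' = i \<and> j' = j then t mod int (m i j) else 0)"

lemma comm_group_product_group:
  assumes "\<And>i. i \<in> I \<Longrightarrow> comm_group (F i)"
  shows "comm_group (product_group I F)"
proof (rule group.group_comm_groupI)
  show "group (product_group I F)"
    using assms by (simp add: comm_group_def)
  show "x \<otimes>\<^bsub>product_group I F\<^esub> y = y \<otimes>\<^bsub>product_group I F\<^esub> x"
    if "x \<in> carrier (product_group I F)" "y \<in> carrier (product_group I F)" for x y
    using that assms by (auto simp: fun_eq_iff PiE_iff intro!: comm_groupE(4))
qed

lemma comm_group_cyclic_product: "comm_group (cyclic_product K L m)"
  unfolding cyclic_product_def by (intro comm_group_product_group) simp

lemma cyclic_product_one: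
  "i \<in> {1..K} \<Longrightarrow> j \<in> {1..L i} \<Longrightarrow> \<one>\<^bsub>cyclic_product K L m\<^esub> i j = 0"
  by (simp add: cyclic_product_def)

lemma cyclic_product_mult:
  "i \<in> {1..K} \<Longrightarrow> j \<in> {1..L i} \<Longrightarrow>
   (x \<otimes>\<^bsub>cyclic_product K L m\<^esub> y) i j = (x i j + y i j) mod int (m i j)"
  by (simp add: cyclic_product_def)

lemma cyclic_product_eqI:
  assumes "x \<in> carrier (cyclic_product K L m)" "y \<in> carrier (cyclic_product K L m)"
    and "\<And>i j. i \<in> {1..K} \<Longrightarrow> j \<in> {1..L i} \<Longrightarrow> x i j = y i j"
  shows "x = y"
proof (rule PiE_ext[of x "{1..K}" _ y])
  show "x \<in> (\<Pi>\<^sub>E i\<in>{1..K}. \<Pi>\<^sub>E j\<in>{1..L i}. carrier (integer_mod_group (m i j)))"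
    and y: "y \<in> (\<Pi>\<^sub>E i\<in>{1..K}. \<Pi>\<^sub>E j\<in>{1..L i}. carrier (integer_mod_group (m i j)))"
    using assms(1,2) by (simp_all add: cyclic_product_def)
  then show "x i = y i" if "i \<in> {1..K}" for i
    using assms(3)[OF that] that by (intro PiE_ext[of "x i" "{1..L i}" _ "y i"]) (auto dest: PiE_mem)
qed

context
  fixes K :: nat and L :: "nat \<Rightarrow> nat" and m :: "nat \<Rightarrow> nat \<Rightarrow> nat"
  assumes pos: "\<And>i j. i \<in> {1..K} \<Longrightarrow> j \<in> {1..L i} \<Longrightarrow> m i j > 0"
begin

lemma cyclic_product_range:
  assumes "x \<in> carrier (cyclic_product K L m)" "i \<in> {1..K}" "j \<in> {1..L i}"
  shows "0 \<le> x i j" "x i j < int (m i j)"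
proof -
  have "x i j \<in> carrier (integer_mod_group (m i j))"
    using assms unfolding cyclic_product_def carrier_product_group by (blast dest: PiE_mem)
  then show "0 \<le> x i j" "x i j < int (m i j)"
    using pos[OF assms(2,3)] by (auto simp: carrier_integer_mod_group)
qed

lemma component_hom:
  assumes "i \<in> {1..K}" "j \<in> {1..L i}"
  shows "(\<lambda>x. x i j) \<in> hom (cyclic_product K L m) (integer_mod_group (m i j))"
  using assms pos[OF assms]
  by (auto simp: hom_def cyclic_product_mult carrier_integer_mod_group cyclic_product_range)

lemma cyclic_product_int_pow:
  assumes "x \<in> carrier (cyclic_product K L m)" "i \<in> {1..K}" "j \<in> {1..L i}"
  shows "(x [^]\<^bsub>cyclic_product K L m\<^esub> (k::int)) i j = (k * x i j) mod int (m i j)"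
  using hom_int_pow[OF component_hom[OF assms(2,3)] assms(1), of k]
    comm_group.axioms(2)[OF comm_group_cyclic_product]
  by (simp add: int_pow_integer_mod_group)

lemma cyclic_product_pow:
  assumes "x \<in> carrier (cyclic_product K L m)" "i \<in> {1..K}" "j \<in> {1..L i}"
  shows "(x [^]\<^bsub>cyclic_product K L m\<^esub> (k::nat)) i j = (int k * x i j) mod int (m i j)"
  using cyclic_product_int_pow[OF assms, of "int k"] by (simp add: int_pow_int)

lemma cyclic_product_finprod:
  assumes "finite S" "h \<in> S \<rightarrow> carrier (cyclic_product K L m)" "i \<in> {1..K}" "j \<in> {1..L i}"
  shows "(\<Otimes>\<^bsub>cyclic_product K L m\<^esub>s\<in>S. h s) i j = (\<Sum>s\<in>S. h s i j) mod int (m i j)"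
proof -
  interpret B: comm_group "cyclic_product K L m" by (rule comm_group_cyclic_product)
  from assms(1,2) show ?thesis
  proof (induction S rule: finite_induct)
    case empty
    then show ?case using assms(3,4) by (simp add: cyclic_product_one)
  next
    case (insert s S)
    then show ?case
      using assms(3,4) by (simp add: Pi_iff cyclic_product_mult mod_add_right_eq)
  qed
qed

lemma coord_closed: "coord K L m i j t \<in> carrier (cyclic_product K L m)"
  using pos by (auto simp: coord_def cyclic_product_def carrier_integer_mod_group)

lemma coord_pow_order:
  assumes "i \<in> {1..K}" "j \<in> {1..L i}"
  shows "coord K L m i j t [^]\<^bsub>cyclic_product K L m\<^esub> m i j = \<one>\<^bsub>cyclic_product K L m\<^esub>"
proof -
  interpret A: comm_group "cyclic_product K L m" by (rule comm_group_cyclic_product)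
  show ?thesis
  proof (rule cyclic_product_eqI[where m = m])
    fix i' j' assume "i' \<in> {1..K}" "j' \<in> {1..L i'}"
    then show "(coord K L m i j t [^]\<^bsub>cyclic_product K L m\<^esub> m i j) i' j' =
        \<one>\<^bsub>cyclic_product K L m\<^esub> i' j'"
      by (simp add: cyclic_product_pow[OF coord_closed] cyclic_product_one) (simp add: coord_def)
  qed (simp_all add: coord_closed)
qed

lemma coord_generate:
  assumes one: "\<one>\<^bsub>cyclic_product K L m\<^esub> \<in> Q"
    and gen: "\<And>i j. i \<in> {1..K} \<Longrightarrow> j \<in> {1..L i} \<Longrightarrow> coord K L m i j 1 \<in> Q"
    and mult: "\<And>a b. a \<in> Q \<Longrightarrow> b \<in> Q \<Longrightarrow> a \<otimes>\<^bsub>cyclic_product K L m\<^esub> b \<in> Q"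
  shows "carrier (cyclic_product K L m) \<subseteq> Q"
proof
  fix x assume x: "x \<in> carrier (cyclic_product K L m)"
  interpret A: comm_group "cyclic_product K L m" by (rule comm_group_cyclic_product)
  define r where "r T = (\<lambda>i\<in>{1..K}. \<lambda>j\<in>{1..L i}. if (i, j) \<in> T then x i j else 0)" for T
  have r: "r T \<in> carrier (cyclic_product K L m)" for T
    using pos cyclic_product_range[OF x]
    by (auto simp: r_def cyclic_product_def carrier_integer_mod_group)
  have pow: "a [^]\<^bsub>cyclic_product K L m\<^esub> (k::nat) \<in> Q" if "a \<in> Q" for a k
    by (induction k) (use that one mult in auto)
  let ?T = "SIGMA i:{1..K}. {1..L i}"
  have "r T \<in> Q" if "finite T" "T \<subseteq> ?T" for T
    using that
  proof (induction T rule: finite_subset_induct)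
    case empty
    have "r {} = \<one>\<^bsub>cyclic_product K L m\<^esub>"
      by (rule cyclic_product_eqI[OF r]) (simp_all add: r_def cyclic_product_one)
    with one show ?case by simp
  next
    case (insert ij T)
    obtain i j where ij: "ij = (i, j)" by (cases ij)
    with insert.hyps have i: "i \<in> {1..K}" and j: "j \<in> {1..L i}" by auto
    have "r (insert ij T) = r T \<otimes>\<^bsub>cyclic_product K L m\<^esub>
        coord K L m i j 1 [^]\<^bsub>cyclic_product K L m\<^esub> nat (x i j)"
    proof (rule cyclic_product_eqI[where m = m])
      fix i' j' assume ij': "i' \<in> {1..K}" "j' \<in> {1..L i'}"
      show "r (insert ij T) i' j' = (r T \<otimes>\<^bsub>cyclic_product K L m\<^esub>
          coord K L m i j 1 [^]\<^bsub>cyclic_product K L m\<^esub> nat (x i j)) i' j'"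
        unfolding cyclic_product_mult[where L = L and m = m, OF ij'] cyclic_product_pow[OF coord_closed ij']
        using ij' insert.hyps cyclic_product_range[OF x ij']
        by (auto simp: r_def coord_def ij mod_mult_right_eq)
    qed (simp_all add: r coord_closed)
    then show ?case
      using insert.IH pow[OF gen[OF i j]] mult by simp
  qed
  moreover have "r ?T = x"
    by (rule cyclic_product_eqI[OF r x]) (simp add: r_def)
  ultimately show "x \<in> Q" by (metis finite_SigmaI finite_atLeastAtMost order_refl)
qed

lemma group_ring_act_component:
  assumes A: "comm_group A" and z: "z \<in> carrier (group_ring A)"
    and f: "f \<in> carrier A \<rightarrow> carrier (cyclic_product K L m)" and x: "x \<in> carrier A"
    and ij: "i \<in> {1..K}" "j \<in> {1..L i}"
  shows "group_ring_act A (cyclic_product K L m) z f x i j =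
    int_act A z (\<lambda>x. f x i j) x mod int (m i j)"
proof -
  interpret A: comm_group A by fact
  interpret B: comm_group "cyclic_product K L m" by (rule comm_group_cyclic_product)
  have f': "f (x \<otimes>\<^bsub>A\<^esub> a) \<in> carrier (cyclic_product K L m)" if "a \<in> Poly_Mapping.keys z" for a
    using that z x f by (auto simp: carrier_group_ring)
  then have "group_ring_act A (cyclic_product K L m) z f x i j =
     (\<Sum>a\<in>Poly_Mapping.keys z. (Poly_Mapping.lookup z a * f (x \<otimes>\<^bsub>A\<^esub> a) i j) mod int (m i j)) mod int (m i j)"
    using x ij
    by (simp add: group_ring_act_def cyclic_product_finprod cyclic_product_int_pow)
  then show ?thesis
    using x by (simp add: int_act_def mod_sum_eq)
qed

lemma annihilates_iff:
  assumes A: "comm_group A" and J: "J \<subseteq> carrier (group_ring A)"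
    and f: "f \<in> carrier A \<rightarrow> carrier (cyclic_product K L m)"
  shows "annihilates A (cyclic_product K L m) J f \<longleftrightarrow>
    (\<forall>i\<in>{1..K}. \<forall>j\<in>{1..L i}. \<forall>z\<in>J. \<forall>x\<in>carrier A. int (m i j) dvd int_act A z (\<lambda>x. f x i j) x)"
proof -
  interpret A: comm_group A by fact
  interpret B: comm_group "cyclic_product K L m" by (rule comm_group_cyclic_product)
  have iff: "group_ring_act A (cyclic_product K L m) z f = (\<lambda>x\<in>carrier A. \<one>\<^bsub>cyclic_product K L m\<^esub>)
    \<longleftrightarrow> (\<forall>i\<in>{1..K}. \<forall>j\<in>{1..L i}. \<forall>x\<in>carrier A. int (m i j) dvd int_act A z (\<lambda>x. f x i j) x)"
    (is "?l \<longleftrightarrow> ?r") if "z \<in> J" for z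
  proof -
    have z: "z \<in> carrier (group_ring A)" using that J by blast
    have clo: "group_ring_act A (cyclic_product K L m) z f x \<in> carrier (cyclic_product K L m)"
      if "x \<in> carrier A" for x
      using that z f by (auto simp: group_ring_act_def carrier_group_ring
        intro!: B.finprod_closed B.int_pow_closed)
    have "?l \<longleftrightarrow> (\<forall>x\<in>carrier A. group_ring_act A (cyclic_product K L m) z f x = \<one>\<^bsub>cyclic_product K L m\<^esub>)"
      by (auto simp: group_ring_act_def fun_eq_iff)
    also have "\<dots> \<longleftrightarrow> (\<forall>x\<in>carrier A. \<forall>i\<in>{1..K}. \<forall>j\<in>{1..L i}.
        group_ring_act A (cyclic_product K L m) z f x i j = 0)"
    proof (rule ball_cong[OF refl])
      fix x assume x: "x \<in> carrier A"
      show "group_ring_act A (cyclic_product K L m) z f x = \<one>\<^bsub>cyclic_product K L m\<^esub> \<longleftrightarrow>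
        (\<forall>i\<in>{1..K}. \<forall>j\<in>{1..L i}. group_ring_act A (cyclic_product K L m) z f x i j = 0)"
        using cyclic_product_eqI[OF clo[OF x] B.one_closed] by (auto simp: cyclic_product_one)
    qed
    also have "\<dots> \<longleftrightarrow> ?r"
      using z by (auto simp: group_ring_act_component[OF A z f] dvd_eq_mod_eq_0)
    finally show ?thesis .
  qed
  show ?thesis
    unfolding annihilates_def using iff by blast
qed

lemma annihilates_augmentation_power_iff:
  assumes A: "comm_group A" and f: "f \<in> carrier A \<rightarrow> carrier (cyclic_product K L m)"
  shows "annihilates A (cyclic_product K L m) (ideal_power (group_ring A) (augmentation_ideal A) n) f
    \<longleftrightarrow> (\<forall>i\<in>{1..K}. \<forall>j\<in>{1..L i}.
      differences_dvd A (carrier A) (int (m i j)) n (\<lambda>x. f x i j))"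
proof -
  interpret A: comm_group A by fact
  interpret R: cring "group_ring A" by (rule group_ring_cring) fact
  have "ideal_power (group_ring A) (augmentation_ideal A) n \<subseteq> carrier (group_ring A)"
  proof (cases "n = 0")
    case False
    have "{finprod (group_ring A) x {1..n} | x. x \<in> {1..n} \<rightarrow> augmentation_ideal A}
        \<subseteq> carrier (group_ring A)"
      using A.augmentation_ideal_subset by (auto intro!: R.finprod_closed)
    with False show ?thesis
      unfolding ideal_power_def by (simp add: R.genideal_minimal R.oneideal)
  qed (simp add: ideal_power_def)
  from annihilates_iff[OF A this f] show ?thesis
    unfolding A.ideal_power_int_act_dvd_iff .
qed

end

section \<open>Functional degree and independence of coordinates\<close>

lemma Fdeg_le_iff:
  "Fdeg A B f \<le> enat N \<longleftrightarrow>
   (\<exists>n\<le>N. annihilates A B (ideal_power (group_ring A) (augmentation_ideal A) (Suc n)) f)"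
  unfolding Fdeg_def Let_def
  by (auto intro: LeastI Least_le order_trans)

lemma Fdeg_finite_iff:
  "Fdeg A B f < \<infinity> \<longleftrightarrow>
   (\<exists>n. annihilates A B (ideal_power (group_ring A) (augmentation_ideal A) (Suc n)) f)"
  unfolding Fdeg_def Let_def by auto

lemma finite_degree_imp_independent:
  fixes p L :: "nat \<Rightarrow> nat" and \<alpha> :: "nat \<Rightarrow> nat \<Rightarrow> nat"
  assumes p: "\<forall>i\<in>{1..K}. Factorial_Ring.prime (p i)"
    and A: "A = cyclic_product K L (\<lambda>i j. p i ^ \<alpha> i j)"
    and V: "differences_dvd A (carrier A) (int q) (Suc n) g"
    and g: "\<And>x. x \<in> carrier A \<Longrightarrow> 0 \<le> g x \<and> g x < int q"
    and i1: "i1 \<in> {1..K}" and j1: "j1 \<in> {1..L i1}" and cop: "coprime (p i1) q"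
    and a: "a \<in> carrier A" "a' \<in> carrier A"
    and eq: "\<And>i j. i \<in> {1..K} \<Longrightarrow> j \<in> {1..L i} \<Longrightarrow> (i, j) \<noteq> (i1, j1) \<Longrightarrow> a i j = a' i j"
  shows "g a = g a'"
proof -
  have pos: "p i ^ \<alpha> i j > 0" if "i \<in> {1..K}" "j \<in> {1..L i}" for i j
    using that p by (simp add: prime_gt_0_nat)
  interpret A: comm_group A unfolding A by (rule comm_group_cyclic_product)
  let ?d = "coord K L (\<lambda>i j. p i ^ \<alpha> i j) i1 j1 (a' i1 j1 - a i1 j1)"
  have d: "?d \<in> carrier A" unfolding A by (rule coord_closed) (rule pos)
  have a': "a \<otimes>\<^bsub>A\<^esub> ?d = a'"
    unfolding A
  proof (rule cyclic_product_eqI)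
    fix i j assume ij: "i \<in> {1..K}" "j \<in> {1..L i}"
    have "a' i j mod int (p i ^ \<alpha> i j) = a' i j"
      using cyclic_product_range[OF pos a(2)[unfolded A] ij] by simp
    then show "(a \<otimes>\<^bsub>cyclic_product K L (\<lambda>i j. p i ^ \<alpha> i j)\<^esub> ?d) i j = a' i j"
      using ij eq[OF ij] by (auto simp: cyclic_product_mult coord_def mod_add_right_eq)
  next
    show "a \<otimes>\<^bsub>cyclic_product K L (\<lambda>i j. p i ^ \<alpha> i j)\<^esub> ?d \<in> carrier (cyclic_product K L (\<lambda>i j. p i ^ \<alpha> i j))"
      using A.m_closed[OF a(1) d] unfolding A .
  qed (use a A in auto)
  have "int q dvd difference A ?d g a"
  proof (rule A.coprime_order_imp_difference_dvd[OF d _ _ _ a(1)])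
    show "?d [^]\<^bsub>A\<^esub> (p i1 ^ \<alpha> i1 j1) = \<one>\<^bsub>A\<^esub>"
      unfolding A by (rule coord_pow_order) (use pos i1 j1 in auto)
    show "coprime (int (p i1 ^ \<alpha> i1 j1)) (int q)"
      using cop by simp
    show "int q dvd (difference A ?d ^^ Suc n) g x" if "x \<in> carrier A" for x
      using differences_dvd_funpow[OF d V that] .
  qed
  then have "int q dvd g a' - g a"
    using a(1) a' by (simp add: difference_def)
  then have "g a' mod int q = g a mod int q" by (simp add: mod_eq_dvd_iff)
  with g[OF a(1)] g[OF a(2)] show ?thesis by simp
qed

lemma block_dependent_imp_differences_dvd:
  fixes p L :: "nat \<Rightarrow> nat" and \<alpha> :: "nat \<Rightarrow> nat \<Rightarrow> nat"
  assumes p: "\<forall>i\<in>{1..K}. Factorial_Ring.prime (p i)"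
    and A: "A = cyclic_product K L (\<lambda>i j. p i ^ \<alpha> i j)"
    and i2: "i2 \<in> {1..K}"
    and indep: "\<And>i1 j1 a a'. i1 \<in> {1..K} \<Longrightarrow> j1 \<in> {1..L i1} \<Longrightarrow> i1 \<noteq> i2 \<Longrightarrow>
      a \<in> carrier A \<Longrightarrow> a' \<in> carrier A \<Longrightarrow>
      (\<forall>i\<in>{1..K}. \<forall>j\<in>{1..L i}. (i, j) \<noteq> (i1, j1) \<longrightarrow> a i j = a' i j) \<Longrightarrow> g a = g a'"
    and n: "n > b * (\<Sum>j = 1..L i2. p i2 ^ \<alpha> i2 j - 1)"
  shows "differences_dvd A (carrier A) (int (p i2 ^ b)) n g"
proof -
  have pos: "p i ^ \<alpha> i j > 0" if "i \<in> {1..K}" "j \<in> {1..L i}" for i j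
    using that p by (simp add: prime_gt_0_nat)
  interpret A: comm_group A unfolding A by (rule comm_group_cyclic_product)
  define u where "u = (\<lambda>(i, j). coord K L (\<lambda>i j. p i ^ \<alpha> i j) i j 1)"
  let ?J = "SIGMA i:{1..K}. {1..L i}" and ?J2 = "{i2} \<times> {1..L i2}"
  have uA: "u k \<in> carrier A" for k
    unfolding A u_def split_def by (rule coord_closed) (rule pos)
  have zero: "difference A (u (i, j)) g = (\<lambda>x. 0)" if "i \<in> {1..K}" "j \<in> {1..L i}" "i \<noteq> i2" for i j
  proof
    fix x
    have "g (x \<otimes>\<^bsub>A\<^esub> u (i, j)) = g x" if x: "x \<in> carrier A"
    proof (rule indep[OF \<open>i \<in> {1..K}\<close> \<open>j \<in> {1..L i}\<close> \<open>i \<noteq> i2\<close>])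
      show "\<forall>i'\<in>{1..K}. \<forall>j'\<in>{1..L i'}. (i', j') \<noteq> (i, j) \<longrightarrow> (x \<otimes>\<^bsub>A\<^esub> u (i, j)) i' j' = x i' j'"
        using cyclic_product_range[OF pos x[unfolded A]]
        by (auto simp: A cyclic_product_mult u_def coord_def)
    qed (use x uA in auto)
    then show "difference A (u (i, j)) g x = 0" by (simp add: difference_def)
  qed
  have "differences_dvd A (u ` ?J) (int (p i2 ^ b)) n g"
    unfolding differences_dvd_image_fold
  proof (intro allI impI)
    fix js x assume js: "set js \<subseteq> ?J" "length js = n" and x: "x \<in> carrier A"
    show "int (p i2 ^ b) dvd fold (\<lambda>j. difference A (u j)) js g x"
    proof (cases "set js \<subseteq> ?J2")
      case True
      have block: "?J2 = Pair i2 ` {1..L i2}" by auto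
      have "(\<Sum>k\<in>?J2. p i2 ^ (\<lambda>(i, j). \<alpha> i j) k - 1) = (\<Sum>j = 1..L i2. p i2 ^ \<alpha> i2 j - 1)"
        unfolding block by (subst sum.reindex) (auto simp: inj_on_def)
      then have "int (p i2) ^ b dvd fold (\<lambda>j. difference A (u j)) js g x"
        using True js n x p i2 uA coord_pow_order[where L = L and m = "\<lambda>i j. p i ^ \<alpha> i j", OF pos]
        by (intro A.prime_power_dvd_fold_difference[where J = ?J2 and \<alpha> = "\<lambda>(i, j). \<alpha> i j"])
           (auto simp: u_def A)
      then show ?thesis by simp
    next
      case False
      then obtain i j where "(i, j) \<in> set js" "i \<noteq> i2" using js by blast
      moreover from this have "i \<in> {1..K}" "j \<in> {1..L i}" using js by auto
      ultimately have "fold (\<lambda>j. difference A (u j)) js g = (\<lambda>x. 0)"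
        using js uA zero by (intro A.fold_difference_eq_zero[where J = ?J and k = "(i, j)"]) auto
      then show ?thesis by simp
    qed
  qed
  moreover have "carrier A \<subseteq> Q"
    if "\<one>\<^bsub>A\<^esub> \<in> Q" "u ` ?J \<subseteq> Q" "\<And>a b. a \<in> Q \<Longrightarrow> b \<in> Q \<Longrightarrow> a \<otimes>\<^bsub>A\<^esub> b \<in> Q" for Q
    unfolding A
  proof (rule coord_generate[OF pos])
    show "coord K L (\<lambda>i j. p i ^ \<alpha> i j) i j 1 \<in> Q" if "i \<in> {1..K}" "j \<in> {1..L i}" for i j
      using \<open>u ` ?J \<subseteq> Q\<close> that by (force simp: u_def)
  qed (use that A in auto)
  ultimately show ?thesis
    using uA by (intro A.differences_dvd_generators[where S = "u ` ?J"]) auto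
qed

theorem theorem9p2:
  fixes K :: nat and p L M :: "nat \<Rightarrow> nat" and \<alpha> \<beta> :: "nat \<Rightarrow> nat \<Rightarrow> nat"
    and A B :: "(nat \<Rightarrow> nat \<Rightarrow> int) monoid"
    and f :: "(nat \<Rightarrow> nat \<Rightarrow> int) \<Rightarrow> (nat \<Rightarrow> nat \<Rightarrow> int)"
  assumes "K \<ge> 1"
    and "\<forall>i\<in>{1..K}. Factorial_Ring.prime (p i)" and "inj_on p {1..K}"
    and "\<forall>i\<in>{1..K}. L i \<ge> 1" and "\<forall>i\<in>{1..K}. M i \<ge> 1"
    and "A = product_group {1..K} (\<lambda>i. product_group {1..L i}
               (\<lambda>j. integer_mod_group (p i ^ \<alpha> i j)))"
    and "B = product_group {1..K} (\<lambda>i. product_group {1..M i}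
               (\<lambda>j. integer_mod_group (p i ^ \<beta> i j)))"
    and "f \<in> carrier A \<rightarrow> carrier B"
  shows "(Fdeg A B f < \<infinity> \<longleftrightarrow>
           (\<forall>i1\<in>{1..K}. \<forall>i2\<in>{1..K}. \<forall>j1\<in>{1..L i1}. \<forall>j2\<in>{1..M i2}. i1 \<noteq> i2 \<longrightarrow>
              (\<forall>a\<in>carrier A. \<forall>a'\<in>carrier A.
                 (\<forall>i\<in>{1..K}. \<forall>j\<in>{1..L i}. (i, j) \<noteq> (i1, j1) \<longrightarrow> a i j = a' i j) \<longrightarrow>
                 f a i2 j2 = f a' i2 j2)))
       \<and> (Fdeg A B f < \<infinity> \<longleftrightarrow>
           Fdeg A B f \<le> enat (MAX i\<in>{1..K}.
             (MAX j\<in>{1..M i}. \<beta> i j) * (\<Sum>j = 1..L i. p i ^ \<alpha> i j - 1)))"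
    (is "(?fin \<longleftrightarrow> ?indep) \<and> (?fin \<longleftrightarrow> _ \<le> enat ?N)")
proof -
  note p = assms(2)
  have A: "A = cyclic_product K L (\<lambda>i j. p i ^ \<alpha> i j)"
    and B: "B = cyclic_product K M (\<lambda>i j. p i ^ \<beta> i j)"
    by (simp_all add: cyclic_product_def assms(6,7))
  have pos: "p i ^ \<beta> i j > 0" if "i \<in> {1..K}" "j \<in> {1..M i}" for i j
    using that p by (simp add: prime_gt_0_nat)
  have comm: "comm_group A" unfolding A by (rule comm_group_cyclic_product)
  have ann: "annihilates A B (ideal_power (group_ring A) (augmentation_ideal A) n) f \<longleftrightarrow>
      (\<forall>i\<in>{1..K}. \<forall>j\<in>{1..M i}. differences_dvd A (carrier A) (int (p i ^ \<beta> i j)) n (\<lambda>x. f x i j))" for n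
    using annihilates_augmentation_power_iff[OF pos comm assms(8)[unfolded B]] unfolding B .
  have indep: ?indep if fin: ?fin
  proof (intro ballI impI)
    fix i1 i2 j1 j2 a a'
    assume i1: "i1 \<in> {1..K}" and i2: "i2 \<in> {1..K}" and j1: "j1 \<in> {1..L i1}" and j2: "j2 \<in> {1..M i2}"
      and ne: "i1 \<noteq> i2" and a: "a \<in> carrier A" and a': "a' \<in> carrier A"
      and eq: "\<forall>i\<in>{1..K}. \<forall>j\<in>{1..L i}. (i, j) \<noteq> (i1, j1) \<longrightarrow> a i j = a' i j"
    obtain n where V: "differences_dvd A (carrier A) (int (p i2 ^ \<beta> i2 j2)) (Suc n) (\<lambda>x. f x i2 j2)"
      using fin i2 j2 unfolding Fdeg_finite_iff ann by blast
    have "p i1 \<noteq> p i2" using assms(3) i1 i2 ne by (auto dest: inj_onD)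
    then have cop: "coprime (p i1) (p i2 ^ \<beta> i2 j2)"
      using p i1 i2 by (simp add: primes_coprime)
    show "f a i2 j2 = f a' i2 j2"
    proof (rule finite_degree_imp_independent[OF p A V _ i1 j1 cop a a'])
      fix x assume "x \<in> carrier A"
      then have "f x \<in> carrier (cyclic_product K M (\<lambda>i j. p i ^ \<beta> i j))"
        using assms(8) B by auto
      from cyclic_product_range[OF pos this i2 j2]
      show "0 \<le> f x i2 j2 \<and> f x i2 j2 < int (p i2 ^ \<beta> i2 j2)" by simp
    qed (use eq in blast)
  qed
  have bound: "Fdeg A B f \<le> enat ?N" if ind: ?indep
  proof -
    have "differences_dvd A (carrier A) (int (p i ^ \<beta> i j)) (Suc ?N) (\<lambda>x. f x i j)"
      if i: "i \<in> {1..K}" and j: "j \<in> {1..M i}" for i j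
    proof (rule block_dependent_imp_differences_dvd[OF p A i])
      let ?S = "\<lambda>i. \<Sum>j = 1..L i. p i ^ \<alpha> i j - 1"
      have "\<beta> i j * ?S i \<le> (MAX j\<in>{1..M i}. \<beta> i j) * ?S i"
        using j by (intro mult_le_mono1 Max_ge) auto
      also have "\<dots> \<le> ?N"
        using i by (intro Max_ge) auto
      finally show "\<beta> i j * ?S i < Suc ?N" by simp
    qed (use ind i j in blast)
    then show ?thesis
      unfolding Fdeg_le_iff ann by blast
  qed
  have "?fin" if "Fdeg A B f \<le> enat ?N"
    using that by (rule order.strict_trans1) simp
  with indep bound show ?thesis by blast
qed

end
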